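(* 1) Let $A$ be a universal matrix of size $n\geq 2$. There exist an integer partition $p=(p_1,\ldots,p_m)$ of $n$, a permutation matrix $\Pi$ of size $m$, and vectors $a^{(j,k)}\in\mathbb{C}^{p_k}$, $j,k=1,\ldots,m$, such that the matrix $A$ is permutation-similar to the block matrix $$ U(p,\Pi):= \begin{pmatrix} B_{p_1 p_1}^{\eta_{11}}[a^{(1,1)}] & B_{p_1 p_2}^{\eta_{12}}[a^{(1,2)}] & \ldots & B_{p_1 p_m}^{\eta_{1m}}[a^{(1,m)}] \\ B_{p_2 p_1}^{\eta_{21}}[a^{(2,1)}] & B_{p_2 p_2}^{\eta_{22}}[a^{(2,2)}] & \ldots & B_{p_2 p_m}^{\eta_{2m}}[a^{(2,m)}] \\ \ldots & \ldots & \ldots & \ldots \\ B_{p_m p_1}^{\eta_{m1}}[a^{(m,1)}] & B_{p_m p_2}^{\eta_{m2}}[a^{(m,2)}] & \ldots & B_{p_m p_m}^{\eta_{mm}}[a^{(m,m)}] \end{pmatrix}, $$ where $\eta=(\eta_{jk})$, $1\leq j,k\leq m$, is the matrix defined by $\eta=\Pi\,\tau_m\,\Pi^T$. 2) The universal matrix $U(p,\Pi)$ depends on $m\left(n-\frac{m+1}{2}\right)$ complex parameters.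
   Context: Universal matrices. Let $A=(a_{jk})$ be a complex square matrix of size $n\geq 2$ with rows $A_1,\ldots,A_n$, and let $\langle x,y\rangle=x_1y_1+\ldots+x_ny_n$. For a nonempty domain $\Omega\subset\mathbb{C}$ and an analytic function $\varphi\in\mathcal{O}(\Omega)$, $\varphi$ acts on vectors componentwise, so $x\mapsto x+\varphi(Ax)$ is the mapping with coordinates $x_j+\varphi\left(\sum_{k=1}^n a_{jk}x_k\right)$, $j=1,\ldots,n$. The matrix $A$ and the function $\varphi$ form a good pair if the Jacobian determinant of this mapping is identically equal to a nonzero constant on the domain $\{x\in\mathbb{C}^n:\langle A_j,x\rangle\in\Omega,\ j=1,\ldots,n\}$, which is assumed to be nonempty. The matrix $A$ is called universal if it forms a good pair with every analytic function, i.e., for any domain $\Omega$ and any $\varphi\in\mathcal{O}(\Omega)$ such that the mapping is well-defined. (Convention: if $A$ has a zero row, the mapping is not defined when $0\notin\Omega$; $A$ is then still called universal if the Jacobian is a nonzero constant for generic analytic $\varphi$. The zero matrix is universal.) Two square matrices $A,B$ of equal size are permutation-similar if $\Pi A\Pi^T=B$ for some permutation matrix $\Pi$. A partition of $n$ is a vector $(p_1,\ldots,p_m)$ of positive integers with $p_1+\ldots+p_m=n$ and $p_1\leq\ldots\leq p_m$. For $a=(a_1,\ldots,a_\ell)\in\mathbb{C}^\ell$, $S_{k\ell}[a]$ is the $k\times\ell$ matrix all of whose $k$ rows equal $(a_1,\ldots,a_\ell)$. $Z_{k\ell}[a]$ is, for $\ell\geq 2$, the $k\times\ell$ matrix all of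 whose $k$ rows equal $(a_1,\ldots,a_{\ell-1},-a_1-\ldots-a_{\ell-1})$, and for $\ell=1$ it is the zero column; thus $Z_{k\ell}[a]$ does not depend on the last coordinate of $a$. Put $B_{k\ell}^{\sigma}[a]:=Z_{k\ell}[a]$ if $\sigma=0$ and $B_{k\ell}^{\sigma}[a]:=S_{k\ell}[a]$ if $\sigma=1$. $\tau_m$ is the $m\times m$ strictly lower triangular matrix all of whose entries below the main diagonal equal $1$ (all other entries $0$); $\tau_1$ is the $1\times1$ zero matrix. The parameters of $U(p,\Pi)$ are the coordinates of the vectors $a^{(j,k)}$ on which its blocks depend: $p_k$ parameters for a block of the form $S_{p_jp_k}[a^{(j,k)}]$ and $p_k-1$ parameters for a block of the form $Z_{p_jp_k}[a^{(j,k)}]$. *)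

theory Defs
  imports "HOL-Complex_Analysis.Complex_Analysis" "Jordan_Normal_Form.Determinant"
begin

hide_const (open) Determinants.det Finite_Cartesian_Product.vec Finite_Cartesian_Product.row
hide_type (open) Finite_Cartesian_Product.vec
unbundle no vec_syntax
unbundle no inner_syntax
no_notation fps_nth (infixl \<open>$\<close> 75)
no_notation fls_nth (infixl \<open>$$\<close> 75)

section \<open>Universal matrices\<close>

text \<open>
  Matrices and vectors are those of the Jordan Normal Form library, so all row, column, block and
  coordinate indices start at 0. The product \<open>scalar_prod\<close> is bilinear: it does not conjugate.
\<close>

definition shear_map :: "complex mat \<Rightarrow> (complex \<Rightarrow> complex) \<Rightarrow> complex vec \<Rightarrow> complex vec" where
  "shear_map A \<phi> x = x + map_vec \<phi> (A *\<^sub>v x)"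

definition shear_domain :: "complex mat \<Rightarrow> complex set \<Rightarrow> complex vec set" where
  "shear_domain A \<Omega> =
     {x \<in> carrier_vec (dim_col A). \<forall>j<dim_row A. scalar_prod (row A j) x \<in> \<Omega>}"

definition partial_deriv :: "nat \<Rightarrow> (complex vec \<Rightarrow> complex) \<Rightarrow> complex vec \<Rightarrow> complex" where
  "partial_deriv k f x = deriv (\<lambda>t. f (x + t \<cdot>\<^sub>v unit_vec (dim_vec x) k)) 0"

definition jacobian_det :: "(complex vec \<Rightarrow> complex vec) \<Rightarrow> complex vec \<Rightarrow> complex" where
  "jacobian_det F x =
     det (mat (dim_vec x) (dim_vec x) (\<lambda>(j,k). partial_deriv k (\<lambda>y. F y $ j) x))"

definition good_pair :: "complex mat \<Rightarrow> complex set \<Rightarrow> (complex \<Rightarrow> complex) \<Rightarrow> bool" where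
  "good_pair A \<Omega> \<phi> \<longleftrightarrow>
     (\<exists>c. c \<noteq> 0 \<and> (\<forall>x \<in> shear_domain A \<Omega>. jacobian_det (shear_map A \<phi>) x = c))"

text \<open>
  A pair \<open>(\<Omega>, \<phi>)\<close> is tested only if the mapping is defined somewhere, that is, if
  \<open>shear_domain A \<Omega>\<close> is nonempty. This also takes care of matrices with a zero row: for
  those the domains \<open>\<Omega>\<close> not containing 0 are disregarded, and the zero matrix is universal.
\<close>

definition universal :: "complex mat \<Rightarrow> bool" where
  "universal A \<longleftrightarrow>
     (\<forall>\<Omega> \<phi>. open \<Omega> \<and> connected \<Omega> \<and> \<Omega> \<noteq> {} \<and> \<phi> holomorphic_on \<Omega> \<and> shear_domain A \<Omega> \<noteq> {}
        \<longrightarrow> good_pair A \<Omega> \<phi>)"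


section \<open>Permutation similarity and partitions\<close>

definition permutation_mat :: "nat \<Rightarrow> 'a :: semiring_1 mat \<Rightarrow> bool" where
  "permutation_mat m P \<longleftrightarrow>
     (\<exists>\<pi>. \<pi> permutes {..<m} \<and> P = mat m m (\<lambda>(i,j). if j = \<pi> i then 1 else 0))"

definition permutation_similar :: "complex mat \<Rightarrow> complex mat \<Rightarrow> bool" where
  "permutation_similar A B \<longleftrightarrow>
     (\<exists>n P. A \<in> carrier_mat n n \<and> B \<in> carrier_mat n n \<and> permutation_mat n P \<and>
        P * A * transpose_mat P = B)"

definition int_partition :: "nat \<Rightarrow> nat list \<Rightarrow> bool" where
  "int_partition n p \<longleftrightarrow> sorted p \<and> (\<forall>q \<in> set p. 0 < q) \<and> sum_list p = n"


section \<open>The matrices \<open>U(p, \<Pi>)\<close>\<close>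

definition S_block :: "nat \<Rightarrow> nat \<Rightarrow> complex vec \<Rightarrow> complex mat" where
  "S_block k l a = mat k l (\<lambda>(r,s). a $ s)"

text \<open>For \<open>l = 1\<close> the sum is empty and the block is the zero column.\<close>

definition Z_block :: "nat \<Rightarrow> nat \<Rightarrow> complex vec \<Rightarrow> complex mat" where
  "Z_block k l a = mat k l (\<lambda>(r,s). if s < l - 1 then a $ s else - (\<Sum>i<l - 1. a $ i))"

definition B_block :: "nat \<Rightarrow> nat \<Rightarrow> nat \<Rightarrow> complex vec \<Rightarrow> complex mat" where
  "B_block \<sigma> k l a = (if \<sigma> = 0 then Z_block k l a else S_block k l a)"

definition tau :: "nat \<Rightarrow> nat mat" where
  "tau m = mat m m (\<lambda>(i,j). if j < i then 1 else 0)"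

definition eta :: "nat \<Rightarrow> nat mat \<Rightarrow> nat mat" where
  "eta m P = P * tau m * transpose_mat P"

definition block_start :: "nat list \<Rightarrow> nat \<Rightarrow> nat" where
  "block_start p j = sum_list (take j p)"

definition block_index :: "nat list \<Rightarrow> nat \<Rightarrow> nat" where
  "block_index p r = (LEAST j. r < block_start p (Suc j))"

text \<open>
  The square block matrix with blocks \<open>M j k\<close> of size \<open>p ! j\<close> times \<open>p ! k\<close>.
\<close>

definition block_mat :: "nat list \<Rightarrow> (nat \<Rightarrow> nat \<Rightarrow> 'a mat) \<Rightarrow> 'a mat" where
  "block_mat p M = mat (sum_list p) (sum_list p) (\<lambda>(r,s).
     let j = block_index p r; k = block_index p s
     in M j k $$ (r - block_start p j, s - block_start p k))"

definition param_family :: "nat list \<Rightarrow> (nat \<Rightarrow> nat \<Rightarrow> complex vec) \<Rightarrow> bool" where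
  "param_family p a \<longleftrightarrow> (\<forall>j<length p. \<forall>k<length p. a j k \<in> carrier_vec (p ! k))"

definition U_mat :: "nat list \<Rightarrow> nat mat \<Rightarrow> (nat \<Rightarrow> nat \<Rightarrow> complex vec) \<Rightarrow> complex mat" where
  "U_mat p P a = block_mat p (\<lambda>j k. B_block (eta (length p) P $$ (j,k)) (p ! j) (p ! k) (a j k))"

text \<open>
  A parameter is a coordinate of one of the vectors \<open>a j k\<close> on which the block at position
  \<open>(j,k)\<close> depends: changing that coordinate alone can change the block.
\<close>

definition depends_on_coord :: "nat \<Rightarrow> (complex vec \<Rightarrow> complex mat) \<Rightarrow> nat \<Rightarrow> bool" where
  "depends_on_coord l B i \<longleftrightarrow>
     (\<exists>a \<in> carrier_vec l. \<exists>b \<in> carrier_vec l. (\<forall>s<l. s \<noteq> i \<longrightarrow> a $ s = b $ s) \<and> B a \<noteq> B b)"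

definition U_parameters :: "nat list \<Rightarrow> nat mat \<Rightarrow> (nat \<times> nat \<times> nat) set" where
  "U_parameters p P =
     {(j,k,i). j < length p \<and> k < length p \<and> i < p ! k \<and>
        depends_on_coord (p ! k) (B_block (eta (length p) P $$ (j,k)) (p ! j) (p ! k)) i}"

lemma depends_on_coord_S_block:
  assumes "0 < k" "i < l"
  shows "depends_on_coord l (S_block k l) i"
proof -
  have "S_block k l (0\<^sub>v l) $$ (0,i) \<noteq> S_block k l (unit_vec l i) $$ (0,i)"
    using assms by (simp add: S_block_def)
  then have "S_block k l (0\<^sub>v l) \<noteq> S_block k l (unit_vec l i)" by metis
  then show ?thesis unfolding depends_on_coord_def
    by (intro bexI[of _ "0\<^sub>v l"] bexI[of _ "unit_vec l i"]) (auto simp: unit_vec_def)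
qed

lemma depends_on_coord_Z_block:
  assumes "0 < k" "i < l"
  shows "depends_on_coord l (Z_block k l) i \<longleftrightarrow> i < l - 1"
proof
  assume i: "i < l - 1"
  have "Z_block k l (0\<^sub>v l) $$ (0,i) \<noteq> Z_block k l (unit_vec l i) $$ (0,i)"
    using assms i by (simp add: Z_block_def)
  then have "Z_block k l (0\<^sub>v l) \<noteq> Z_block k l (unit_vec l i)" by metis
  then show "depends_on_coord l (Z_block k l) i" unfolding depends_on_coord_def
    by (intro bexI[of _ "0\<^sub>v l"] bexI[of _ "unit_vec l i"]) (auto simp: unit_vec_def)
next
  assume "depends_on_coord l (Z_block k l) i"
  then obtain a b where ab: "\<And>s. s < l \<Longrightarrow> s \<noteq> i \<Longrightarrow> a $ s = b $ s"
    and neq: "Z_block k l a \<noteq> Z_block k l b"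
    unfolding depends_on_coord_def by blast
  show "i < l - 1"
  proof (rule ccontr)
    assume "\<not> i < l - 1"
    then have eq: "a $ s = b $ s" if "s < l - 1" for s using ab[of s] that by auto
    have "Z_block k l a = Z_block k l b"
      unfolding Z_block_def by (rule cong_mat) (auto simp: eq)
    with neq show False by contradiction
  qed
qed

end

(*
  The Jacobian matrix of x + phi(Ax) is I + DA with D the diagonal matrix of the values
  phi'(<A_r, x>), so D is constant on the classes of equal rows of A. The structure of a universal
  matrix is therefore governed by the class sums of A, the sums of a row over the columns belonging
  to one class.

  If in some nonempty set T of classes every row had a nonzero class sum over a class of T, a
  generic vector v supported on T and constant on classes would have (Av)_r nonzero on all of T.
  As the distinct rows are separated by a generic x, a polynomial phi can be chosen with
  phi'(<A_r, x>) = -v_r / (Av)_r on T, and 0 outside T; then v is in the kernel of the Jacobian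
  matrix. So every T contains a class with vanishing class sums over T, and the classes can be
  ordered such that the matrix of class sums is strictly triangular.

  Conversely, an eigenvector of DA for a nonzero eigenvalue is constant on classes, hence also an
  eigenvector of a strictly triangular matrix. So all eigenvalues of DA vanish and det (I + DA) = 1.
*)

theory Submission
  imports Defs "Jordan_Normal_Form.Char_Poly"
begin

section \<open>The Jacobian determinant\<close>

text \<open>With \<open>K = - N\<close>, the determinant is the characteristic polynomial of
  \<open>K\<close> at 1. Without nonzero eigenvalues this polynomial is a power of the variable,
  which takes the value 1 there.\<close>

lemma det_one_plus_eq_1:
  fixes N :: "complex mat"
  assumes N: "N \<in> carrier_mat n n"
    and ev: "\<And>v \<mu>. v \<in> carrier_vec n \<Longrightarrow> \<mu> \<noteq> 0 \<Longrightarrow> N *\<^sub>v v = \<mu> \<cdot>\<^sub>v v \<Longrightarrow> v = 0\<^sub>v n"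
  shows "det (1\<^sub>m n + N) = 1"
proof -
  define K where "K = - N"
  have K: "K \<in> carrier_mat n n" using N by (simp add: K_def)
  obtain as where as: "char_poly K = (\<Prod>a\<leftarrow>as. [:- a, 1:])"
    using char_poly_factorized[OF K] by blast
  have "a = 0" if "a \<in> set as" for a
  proof (rule ccontr)
    assume "a \<noteq> 0"
    have "poly (char_poly K) a = 0"
      using that unfolding as by (auto simp: poly_prod_list prod_list_zero_iff)
    then obtain v where v: "v \<in> carrier_vec n" "v \<noteq> 0\<^sub>v n" "K *\<^sub>v v = a \<cdot>\<^sub>v v"
      using K unfolding eigenvalue_root_char_poly[OF K, symmetric] eigenvalue_def eigenvector_def
      by auto
    have "N *\<^sub>v v = - (K *\<^sub>v v)"
      using N v(1) by (auto simp: K_def intro!: eq_vecI)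
    also have "\<dots> = (- a) \<cdot>\<^sub>v v"
      using v by (auto intro!: eq_vecI)
    finally show False using ev[OF v(1), of "- a"] v(2) \<open>a \<noteq> 0\<close> by simp
  qed
  then have "poly (char_poly K) 1 = 1"
    unfolding as by (induction as) auto
  \<comment> \<open>\<open>char_matrix K 1\<close> is K - 1, so its negative is 1 + N.\<close>
  moreover have "- (char_matrix K 1) = 1\<^sub>m n + N"
    using N by (intro eq_matI) (auto simp: char_matrix_def K_def)
  ultimately show ?thesis
    unfolding char_poly_matrix[OF K] by simp
qed

text \<open>Chain rule along the line x + t e_k: the argument of \<phi> in coordinate j moves with
  slope a_jk.\<close>

lemma jacobian_det_shear_map:
  assumes A: "A \<in> carrier_mat n n" and "open \<Omega>" "\<phi> holomorphic_on \<Omega>" and x: "x \<in> shear_domain A \<Omega>"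
  shows "jacobian_det (shear_map A \<phi>) x =
    det (1\<^sub>m n + mat n n (\<lambda>(j,k). deriv \<phi> (scalar_prod (row A j) x) * A $$ (j,k)))"
proof -
  have xn: "x \<in> carrier_vec n" using x A by (auto simp: shear_domain_def)
  have "partial_deriv k (\<lambda>y. shear_map A \<phi> y $ j) x =
      (if j = k then 1 else 0) + deriv \<phi> (scalar_prod (row A j) x) * A $$ (j,k)"
    if jk: "j < n" "k < n" for j k
  proof -
    define y where "y = scalar_prod (row A j) x"
    have "y \<in> \<Omega>" using x A jk by (auto simp: shear_domain_def y_def)
    then have "(\<phi> has_field_derivative deriv \<phi> y) (at y)"
      using assms holomorphic_derivI by blast
    then have der: "((\<lambda>t. \<phi> (y + t * A $$ (j,k))) has_field_derivative
        deriv \<phi> y * A $$ (j,k)) (at 0)"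
      by (intro DERIV_chain2[where f = \<phi> and g = "\<lambda>t. y + t * A $$ (j,k)"])
        (auto intro!: derivative_eq_intros)
    have "(\<lambda>t. shear_map A \<phi> (x + t \<cdot>\<^sub>v unit_vec (dim_vec x) k) $ j) =
        (\<lambda>t. x $ j + t * (if j = k then 1 else 0) + \<phi> (y + t * A $$ (j,k)))"
    proof
      fix t
      have "scalar_prod (row A j) (x + t \<cdot>\<^sub>v unit_vec n k) = y + t * A $$ (j,k)"
        using A xn jk by (simp add: scalar_prod_add_distrib[of _ n] y_def)
      then show "shear_map A \<phi> (x + t \<cdot>\<^sub>v unit_vec (dim_vec x) k) $ j =
          x $ j + t * (if j = k then 1 else 0) + \<phi> (y + t * A $$ (j,k))"
        using A xn jk by (auto simp: shear_map_def)
    qed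
    moreover have "((\<lambda>t. x $ j + t * (if j = k then 1 else 0) + \<phi> (y + t * A $$ (j,k)))
        has_field_derivative (if j = k then 1 else 0) + deriv \<phi> y * A $$ (j,k)) (at 0)"
      by (intro DERIV_add der) (auto intro!: derivative_eq_intros)
    ultimately show ?thesis
      unfolding partial_deriv_def y_def by (metis DERIV_imp_deriv)
  qed
  then show ?thesis
    unfolding jacobian_det_def using xn
    by (intro arg_cong[of _ _ det] eq_matI) auto
qed

section \<open>Genericity, interpolation and ordering\<close>

text \<open>Finitely many nonzero linear forms do not vanish at a generic point of the moment curve:
  substituting powers of one variable z with distinct exponents turns them into nonzero polynomials,
  which have finitely many roots in total.\<close>

lemma ex_common_nonzero:
  fixes w :: "'j \<Rightarrow> 'i \<Rightarrow> 'a :: {idom, ring_char_0}"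
  assumes "finite J" "finite T" and nz: "\<And>j. j \<in> J \<Longrightarrow> \<exists>i\<in>T. w j i \<noteq> 0"
  shows "\<exists>x. \<forall>j\<in>J. (\<Sum>i\<in>T. w j i * x i) \<noteq> 0"
proof -
  obtain g :: "'i \<Rightarrow> nat" where g: "inj_on g T"
    using finite_imp_inj_to_nat_seg[OF \<open>finite T\<close>] by blast
  define q where "q j = (\<Sum>i\<in>T. monom (w j i) (g i))" for j
  have "q j \<noteq> 0" if j: "j \<in> J" for j
  proof -
    obtain i where i: "i \<in> T" "w j i \<noteq> 0" using nz[OF j] by blast
    \<comment> \<open>As \<open>g\<close> is injective on \<open>T\<close>, no two monomials merge
      and each weight survives as a coefficient.\<close>
    have "coeff (q j) (g i) = (\<Sum>i'\<in>T. if i' = i then w j i' else 0)"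
      unfolding q_def coeff_sum using g i(1) by (intro sum.cong) (auto dest: inj_onD)
    also have "\<dots> = w j i" using i(1) \<open>finite T\<close> by simp
    finally show ?thesis using i(2) by auto
  qed
  then have "finite (\<Union>j\<in>J. {z. poly (q j) z = 0})"
    using \<open>finite J\<close> poly_roots_finite by blast
  then obtain z where "z \<notin> (\<Union>j\<in>J. {z. poly (q j) z = 0})"
    using ex_new_if_finite infinite_UNIV_char_0 by blast
  then have "\<forall>j\<in>J. (\<Sum>i\<in>T. w j i * z ^ g i) \<noteq> 0"
    by (auto simp: q_def poly_sum poly_monom)
  then show ?thesis by (rule exI[of _ "\<lambda>i. z ^ g i"])
qed

text \<open>Interpolation for derivatives, one point at a time: the correction has double zeros at
  the old points, so its derivative vanishes there, and a simple zero at the new point.\<close>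

lemma ex_poly_pderiv_interpolation:
  fixes Y :: "'a :: field_char_0 set"
  assumes "finite Y"
  shows "\<exists>q. \<forall>y\<in>Y. poly (pderiv q) y = d y"
  using assms
proof induction
  case empty
  then show ?case by simp
next
  case (insert z Y)
  then obtain q where q: "\<forall>y\<in>Y. poly (pderiv q) y = d y" by blast
  define h where "h = (\<Prod>y\<in>Y. [:- y, 1:])"
  have hY: "poly h y = 0" if "y \<in> Y" for y
    using that \<open>finite Y\<close> by (auto simp: h_def poly_prod prod_zero_iff)
  have hz: "poly h z \<noteq> 0"
    using insert.hyps by (auto simp: h_def poly_prod prod_zero_iff)
  define l where "l = [:- z, 1:]"
  have l: "poly l y = y - z" "pderiv l = 1" for y
    by (simp_all add: l_def pderiv_pCons)
  \<comment> \<open>The derivative of \<open>h * h * l\<close> at \<open>z\<close> is the square of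
    \<open>poly h z\<close>; \<open>c\<close> scales it to the missing amount.\<close>
  define c where "c = (d z - poly (pderiv q) z) / (poly h z * poly h z)"
  have "poly (pderiv (q + Polynomial.smult c (h * h * l))) y = d y" if "y \<in> insert z Y" for y
    using that q hY hz by (auto simp: pderiv_add pderiv_smult pderiv_mult l c_def)
  then show ?case by blast
qed

text \<open>Topological sorting: repeatedly remove an element without successors among the remaining
  ones. Singletons \<open>T\<close> show that \<open>R\<close> is irreflexive.\<close>

lemma ex_order_of_sinks:
  fixes R :: "'a \<Rightarrow> 'a \<Rightarrow> bool"
  assumes "finite Q" and "\<And>T. T \<subseteq> Q \<Longrightarrow> T \<noteq> {} \<Longrightarrow> \<exists>i\<in>T. \<forall>j\<in>T. \<not> R i j"
  shows "\<exists>ord. bij_betw ord Q {..<card Q} \<and> (\<forall>i\<in>Q. \<forall>j\<in>Q. R i j \<longrightarrow> ord j < (ord i :: nat))"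
  using assms
proof (induction "card Q" arbitrary: Q)
  case 0
  then have "Q = {}" by simp
  then show ?case by (intro exI[of _ "\<lambda>_. 0"]) (simp add: bij_betw_def)
next
  case (Suc m)
  then have "Q \<noteq> {}" by auto
  then obtain i where i: "i \<in> Q" "\<forall>j\<in>Q. \<not> R i j"
    using Suc.prems(2)[of Q] by auto
  have m: "m = card (Q - {i})" using Suc.hyps(2) Suc.prems(1) i(1) by simp
  have "\<exists>i\<in>T. \<forall>j\<in>T. \<not> R i j" if "T \<subseteq> Q - {i}" "T \<noteq> {}" for T
    using Suc.prems(2)[of T] that by auto
  then obtain ord where ord: "bij_betw ord (Q - {i}) {..<m}"
    "\<forall>a\<in>Q - {i}. \<forall>j\<in>Q - {i}. R a j \<longrightarrow> ord j < (ord a :: nat)"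
    using Suc.hyps(1)[OF m] Suc.prems(1) unfolding m[symmetric] by auto
  \<comment> \<open>The sink comes first and everything else moves up by one.\<close>
  define ord' where "ord' = (\<lambda>a. if a = i then 0 else Suc (ord a))"
  have "bij_betw (Suc \<circ> ord) (Q - {i}) (Suc ` {..<m})"
    using ord(1) by (rule bij_betw_trans) (simp add: bij_betw_def)
  then have "bij_betw ord' (Q - {i}) (Suc ` {..<m})"
    by (rule bij_betw_cong[THEN iffD1, rotated]) (auto simp: ord'_def)
  then have "bij_betw ord' ((Q - {i}) \<union> {i}) (Suc ` {..<m} \<union> {0})"
    by (rule bij_betw_combine) (auto simp: bij_betw_def ord'_def)
  moreover have "(Q - {i}) \<union> {i} = Q" using i(1) by auto
  moreover have "Suc ` {..<m} \<union> {0} = {..<card Q}"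
    using Suc.hyps(2)[symmetric] by (simp add: lessThan_Suc_eq_insert_0)
  moreover have "\<forall>a\<in>Q. \<forall>j\<in>Q. R a j \<longrightarrow> ord' j < ord' a"
    using i(2) ord(2) by (auto simp: ord'_def)
  ultimately show ?case by metis
qed

section \<open>Universality and class sums\<close>

text \<open>The classes are given by a function \<open>c\<close> that may be finer than equality of
  rows; this covers matrices U(p, \<Pi>) in which two different block rows happen to
  coincide.\<close>

lemma universal_if_triangular_class_sums:
  fixes c :: "nat \<Rightarrow> nat"
  assumes A: "A \<in> carrier_mat n n"
    and rows: "\<And>r r'. r < n \<Longrightarrow> r' < n \<Longrightarrow> c r = c r' \<Longrightarrow> row A r = row A r'"
    and sums: "\<And>r \<kappa>. r < n \<Longrightarrow> c r \<le> \<kappa> \<Longrightarrow> (\<Sum>s | s < n \<and> c s = \<kappa>. A $$ (r,s)) = 0"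
  shows "universal A"
  unfolding universal_def good_pair_def
proof (intro allI impI exI[of _ 1] conjI ballI)
  fix \<Omega> \<phi> x
  assume hyp: "open \<Omega> \<and> connected \<Omega> \<and> \<Omega> \<noteq> {} \<and> \<phi> holomorphic_on \<Omega> \<and> shear_domain A \<Omega> \<noteq> {}"
    and x: "x \<in> shear_domain A \<Omega>"
  define d where "d r = deriv \<phi> (scalar_prod (row A r) x)" for r
  define N where "N = mat n n (\<lambda>(j,k). d j * A $$ (j,k))"
  have N: "N \<in> carrier_mat n n" by (simp add: N_def)
  have "v = 0\<^sub>v n" if v: "v \<in> carrier_vec n" and \<mu>: "\<mu> \<noteq> 0" and ev: "N *\<^sub>v v = \<mu> \<cdot>\<^sub>v v" for v \<mu>
  proof -
    have eq: "\<mu> * v $ r = d r * scalar_prod (row A r) v" if r: "r < n" for r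
    proof -
      have "\<mu> * v $ r = (N *\<^sub>v v) $ r" using v r by (simp add: ev)
      also have "\<dots> = (\<Sum>s = 0..<n. d r * (A $$ (r,s) * v $ s))"
        using v r N by (simp add: N_def scalar_prod_def mult.assoc)
      also have "\<dots> = d r * scalar_prod (row A r) v"
        using v r A by (simp add: scalar_prod_def sum_distrib_left)
      finally show ?thesis .
    qed
    \<comment> \<open>The right-hand side of \<open>eq\<close> depends on r only through its row, so
      dividing by \<mu> makes v constant on classes.\<close>
    have same: "v $ r = v $ r'" if "r < n" "r' < n" "c r = c r'" for r r'
    proof -
      have "\<mu> * v $ r = \<mu> * v $ r'"
        using eq[of r] eq[of r'] rows[OF that] that by (simp add: d_def)
      then show ?thesis using \<mu> by simp
    qed
    have "v $ r = 0" if "r < n" for r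
      using that
    proof (induction "c r" arbitrary: r rule: less_induct)
      case less
      have "scalar_prod (row A r) v = (\<Sum>s | s < n. A $$ (r,s) * v $ s)"
        using v A less.prems by (auto simp: scalar_prod_def intro!: sum.cong)
      also have "\<dots> = (\<Sum>\<kappa>\<in>c ` {s. s < n}. \<Sum>s | s \<in> {s. s < n} \<and> c s = \<kappa>. A $$ (r,s) * v $ s)"
        by (rule sum.group[symmetric]) auto
      also have "\<dots> = 0"
      proof (rule sum.neutral, rule ballI)
        fix \<kappa> assume "\<kappa> \<in> c ` {s. s < n}"
        then obtain s0 where s0: "s0 < n" "c s0 = \<kappa>" by auto
        \<comment> \<open>On lower classes v vanishes by induction. On the class of r and on higher
          ones the constant value of v factors out of a class sum that is zero.\<close>
        show "(\<Sum>s | s \<in> {s. s < n} \<and> c s = \<kappa>. A $$ (r,s) * v $ s) = 0"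
        proof (cases "\<kappa> < c r")
          case True
          then show ?thesis using less.hyps by (intro sum.neutral) simp
        next
          case False
          have "(\<Sum>s | s \<in> {s. s < n} \<and> c s = \<kappa>. A $$ (r,s) * v $ s) =
              (\<Sum>s | s < n \<and> c s = \<kappa>. A $$ (r,s) * v $ s0)"
            using same[OF _ s0(1)] s0(2) by (intro sum.cong) (simp_all only: mem_Collect_eq)
          also have "\<dots> = 0"
            using sums[OF less.prems, of \<kappa>] False by (simp flip: sum_distrib_right)
          finally show ?thesis .
        qed
      qed
      finally show ?case using eq[OF less.prems] \<mu> by simp
    qed
    then show ?thesis using v by (intro eq_vecI) auto
  qed
  then have "det (1\<^sub>m n + N) = 1" by (intro det_one_plus_eq_1 N)
  then show "jacobian_det (shear_map A \<phi>) x = 1"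
    using jacobian_det_shear_map[OF A _ _ x] hyp by (simp add: N_def d_def)
qed simp

text \<open>Differences of distinct vectors are nonzero linear forms, so a generic x is a zero of
  none of them.\<close>

lemma ex_separating_vec:
  fixes Q :: "'a :: {idom, ring_char_0} vec set"
  assumes "finite Q" "Q \<subseteq> carrier_vec n"
  shows "\<exists>x\<in>carrier_vec n. inj_on (\<lambda>\<rho>. scalar_prod \<rho> x) Q"
proof -
  let ?J = "{(\<rho>,\<rho>') \<in> Q \<times> Q. \<rho> \<noteq> \<rho>'}"
  have "finite ?J" using assms(1) by (intro finite_subset[of ?J "Q \<times> Q"]) auto
  moreover have "\<exists>i\<in>{0..<n}. fst j $ i - snd j $ i \<noteq> 0" if "j \<in> ?J" for j
  proof (rule ccontr)
    assume "\<not> ?thesis"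
    moreover have "fst j \<in> carrier_vec n" "snd j \<in> carrier_vec n" using that assms(2) by auto
    ultimately have "fst j = snd j" by (intro eq_vecI) auto
    then show False using that by auto
  qed
  ultimately obtain y where
    y: "\<forall>j\<in>?J. (\<Sum>i = 0..<n. (fst j $ i - snd j $ i) * y i) \<noteq> 0"
    using ex_common_nonzero[of ?J "{0..<n}" "\<lambda>j i. fst j $ i - snd j $ i"] by auto
  have "inj_on (\<lambda>\<rho>. scalar_prod \<rho> (vec n y)) Q"
  proof (rule inj_onI, rule ccontr)
    fix \<rho> \<rho>' assume *: "\<rho> \<in> Q" "\<rho>' \<in> Q" "scalar_prod \<rho> (vec n y) = scalar_prod \<rho>' (vec n y)" "\<rho> \<noteq> \<rho>'"
    then have "(\<Sum>i = 0..<n. (\<rho> $ i - \<rho>' $ i) * y i) = 0"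
      by (simp add: scalar_prod_def left_diff_distrib sum_subtractf)
    then show False using y * by auto
  qed
  then show ?thesis by (meson vec_carrier)
qed

text \<open>A class is represented by its common row, so \<open>T\<close> is a set of row vectors
  and \<open>row A s = \<rho>'\<close> selects the columns of one class.\<close>

lemma universal_imp_sink:
  assumes A: "A \<in> carrier_mat n n" and univ: "universal A"
    and T: "T \<subseteq> row A ` {..<n}" "T \<noteq> {}"
  shows "\<exists>\<rho>\<in>T. \<forall>\<rho>'\<in>T. (\<Sum>s | s < n \<and> row A s = \<rho>'. \<rho> $ s) = 0"
proof (rule ccontr)
  define b where "b \<rho> \<rho>' = (\<Sum>s | s < n \<and> row A s = \<rho>'. \<rho> $ s)" for \<rho> \<rho>' :: "complex vec"
  assume "\<not> ?thesis"
  then have *: "\<exists>\<rho>'\<in>T. b \<rho> \<rho>' \<noteq> 0" if "\<rho> \<in> T" for \<rho> using that by (auto simp: b_def)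
  have finQ: "finite (row A ` {..<n})" by simp
  with T(1) have finT: "finite T" by (rule finite_subset)
  \<comment> \<open>\<open>u\<close> prescribes the value of the kernel vector \<open>v\<close> on
    each class of \<open>T\<close>. Then \<open>w\<close> is the value of Av on a class, and
    \<open>t\<close> is the value that \<phi>' must take there.\<close>
  obtain u where u: "\<forall>\<rho>\<in>T. (\<Sum>\<rho>'\<in>T. b \<rho> \<rho>' * u \<rho>') \<noteq> 0"
    using ex_common_nonzero[of T T b, OF finT finT *] by blast
  define w where "w \<rho> = (\<Sum>\<rho>'\<in>T. b \<rho> \<rho>' * u \<rho>')" for \<rho>
  define v where "v = vec n (\<lambda>r. if row A r \<in> T then u (row A r) else 0)"
  define t where "t \<rho> = (if \<rho> \<in> T then - u \<rho> / w \<rho> else 0)" for \<rho>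
  have "row A ` {..<n} \<subseteq> carrier_vec n" using A by auto
  then obtain x where x: "x \<in> carrier_vec n" and inj: "inj_on (\<lambda>\<rho>. scalar_prod \<rho> x) (row A ` {..<n})"
    using ex_separating_vec[OF finQ] by blast
  \<comment> \<open>Injectivity on the rows lets the prescribed derivative be read off from the
    point at which \<phi>' is evaluated.\<close>
  define d where "d y = t (the_inv_into (row A ` {..<n}) (\<lambda>\<rho>. scalar_prod \<rho> x) y)" for y
  obtain q where q: "\<forall>y\<in>(\<lambda>\<rho>. scalar_prod \<rho> x) ` row A ` {..<n}. poly (pderiv q) y = d y"
    using ex_poly_pderiv_interpolation[of "(\<lambda>\<rho>. scalar_prod \<rho> x) ` row A ` {..<n}" d] finQ by blast
  have der: "deriv (poly q) (scalar_prod (row A r) x) = t (row A r)" if "r < n" for r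
  proof -
    have "deriv (poly q) (scalar_prod (row A r) x) = poly (pderiv q) (scalar_prod (row A r) x)"
      by (rule DERIV_imp_deriv) (rule poly_DERIV)
    then show ?thesis
      using q that the_inv_into_f_f[OF inj, of "row A r"] by (simp add: d_def)
  qed
  have dom: "x \<in> shear_domain A UNIV" using x A by (simp add: shear_domain_def)
  define M where "M = 1\<^sub>m n + mat n n (\<lambda>(j,k). t (row A j) * A $$ (j,k))"
  have M: "M \<in> carrier_mat n n" by (simp add: M_def)
  have holo: "poly q holomorphic_on UNIV" by (intro holomorphic_intros)
  have "M = 1\<^sub>m n + mat n n (\<lambda>(j,k). deriv (poly q) (scalar_prod (row A j) x) * A $$ (j,k))"
    by (intro eq_matI) (simp_all add: M_def der)
  then have jac: "jacobian_det (shear_map A (poly q)) x = det M"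
    using jacobian_det_shear_map[OF A open_UNIV holo dom] by simp
  have "good_pair A UNIV (poly q)"
    using univ dom holo unfolding universal_def by blast
  then have "det M \<noteq> 0" using dom jac unfolding good_pair_def by auto
  moreover have "det M = 0"
  proof -
    have "v \<in> carrier_vec n" by (simp add: v_def)
    moreover have "v \<noteq> 0\<^sub>v n"
    proof
      assume 0: "v = 0\<^sub>v n"
      have "u \<rho> = 0" if \<rho>: "\<rho> \<in> T" for \<rho>
      proof -
        obtain r where r: "r < n" "\<rho> = row A r" using T(1) \<rho> by auto
        then have "v $ r = u \<rho>" using \<rho> by (simp add: v_def)
        then show ?thesis using r 0 by simp
      qed
      then show False using u T(2) by auto
    qed
    moreover have "M *\<^sub>v v = 0\<^sub>v n"
    proof (rule eq_vecI)
      fix r assume "r < dim_vec (0\<^sub>v n)"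
      then have r: "r < n" by simp
      let ?\<rho> = "row A r"
      \<comment> \<open>\<open>v\<close> vanishes off \<open>T\<close> and is constant on classes,
        so grouping the columns by class produces class sums.\<close>
      have "(\<Sum>s = 0..<n. A $$ (r,s) * v $ s) = (\<Sum>s | s < n \<and> row A s \<in> T. ?\<rho> $ s * u (row A s))"
        using r A by (intro sum.mono_neutral_cong_right) (auto simp: v_def)
      also have "\<dots> = (\<Sum>\<rho>'\<in>T. \<Sum>s | s \<in> {s. s < n \<and> row A s \<in> T} \<and> row A s = \<rho>'. ?\<rho> $ s * u (row A s))"
        using finT by (intro sum.group[symmetric]) auto
      also have "\<dots> = (\<Sum>\<rho>'\<in>T. \<Sum>s | s < n \<and> row A s = \<rho>'. ?\<rho> $ s * u \<rho>')"
        by (intro sum.cong) auto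
      also have "\<dots> = w ?\<rho>" by (simp add: w_def b_def sum_distrib_right)
      finally have w: "(\<Sum>s = 0..<n. A $$ (r,s) * v $ s) = w ?\<rho>" .
      have "(M *\<^sub>v v) $ r = (\<Sum>s = 0..<n. (if r = s then v $ s else 0) + t ?\<rho> * (A $$ (r,s) * v $ s))"
        using r by (auto simp: M_def v_def scalar_prod_def algebra_simps intro!: sum.cong)
      also have "\<dots> = v $ r + t ?\<rho> * w ?\<rho>"
        using r by (simp add: sum.distrib flip: w sum_distrib_left)
      \<comment> \<open>For a row in \<open>T\<close> the quotient in \<open>t\<close> cancels, as
        \<open>w\<close> is nonzero there; for other rows both \<open>v $ r\<close> and
        \<open>t\<close> are 0.\<close>
      also have "\<dots> = 0" using u r by (simp add: t_def v_def w_def[symmetric])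
      finally show "(M *\<^sub>v v) $ r = 0\<^sub>v n $ r" using r by simp
    qed (use M in simp)
    ultimately show ?thesis using det_0_iff_vec_prod_zero_field[OF M] by blast
  qed
  ultimately show False by contradiction
qed

lemma universal_imp_triangular_class_sums:
  assumes A: "A \<in> carrier_mat n n" and univ: "universal A"
  obtains c :: "nat \<Rightarrow> nat" and m where "c ` {..<n} = {..<m}"
    and "\<And>r r'. r < n \<Longrightarrow> r' < n \<Longrightarrow> c r = c r' \<Longrightarrow> row A r = row A r'"
    and "\<And>r \<kappa>. r < n \<Longrightarrow> c r \<le> \<kappa> \<Longrightarrow> (\<Sum>s | s < n \<and> c s = \<kappa>. A $$ (r,s)) = 0"
proof -
  define Q where "Q = row A ` {..<n}"
  define R where "R \<rho> \<rho>' \<longleftrightarrow> (\<Sum>s | s < n \<and> row A s = \<rho>'. \<rho> $ s) \<noteq> 0" for \<rho> \<rho>' :: "complex vec"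
  have "\<exists>\<rho>\<in>T. \<forall>\<rho>'\<in>T. \<not> R \<rho> \<rho>'" if "T \<subseteq> Q" "T \<noteq> {}" for T
    using universal_imp_sink[OF A univ that[unfolded Q_def]] unfolding R_def by simp
  then obtain ord where bij: "bij_betw ord Q {..<card Q}"
    and ord: "\<forall>\<rho>\<in>Q. \<forall>\<rho>'\<in>Q. R \<rho> \<rho>' \<longrightarrow> ord \<rho>' < (ord \<rho> :: nat)"
    using ex_order_of_sinks[of Q R] by (auto simp: Q_def)
  have inj: "row A r = row A r'" if "r < n" "r' < n" "ord (row A r) = ord (row A r')" for r r'
    using bij that by (auto simp: bij_betw_def Q_def dest: inj_onD)
  show thesis
  proof (rule that[of "\<lambda>r. ord (row A r)" "card Q"])
    show "(\<lambda>r. ord (row A r)) ` {..<n} = {..<card Q}"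
      using bij by (simp add: bij_betw_def Q_def image_image)
  next
    fix r \<kappa> assume r: "r < n" "ord (row A r) \<le> \<kappa>"
    show "(\<Sum>s | s < n \<and> ord (row A s) = \<kappa>. A $$ (r,s)) = 0"
    proof (cases "\<exists>s<n. ord (row A s) = \<kappa>")
      case True
      then obtain s0 where s0: "s0 < n" "ord (row A s0) = \<kappa>" by blast
      \<comment> \<open>A nonzero class sum would put the class of \<open>s0\<close> strictly before
        that of \<open>r\<close>, against the choice of \<kappa>.\<close>
      have "\<not> R (row A r) (row A s0)" using ord r s0 by (fastforce simp: Q_def)
      then have "(\<Sum>s | s < n \<and> row A s = row A s0. row A r $ s) = 0" by (simp add: R_def)
      moreover have "(\<Sum>s | s < n \<and> ord (row A s) = \<kappa>. A $$ (r,s)) =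
          (\<Sum>s | s < n \<and> row A s = row A s0. row A r $ s)"
        using r s0 A inj by (intro sum.cong) auto
      ultimately show ?thesis by simp
    next
      case False
      then have "{s. s < n \<and> ord (row A s) = \<kappa>} = {}" by auto
      then show ?thesis by (simp only: sum.empty)
    qed
  qed (fact inj)
qed

section \<open>Block matrices\<close>

lemma block_start_Suc: "k < length p \<Longrightarrow> block_start p (Suc k) = block_start p k + p ! k"
  by (simp add: block_start_def take_Suc_conv_app_nth)

lemma block_start_length: "block_start p (length p) = sum_list p"
  by (simp add: block_start_def)

lemma block_start_mono: "j \<le> k \<Longrightarrow> block_start p j \<le> block_start p k"
  by (auto simp: block_start_def take_add dest!: le_Suc_ex)

lemma block_start_add_less:
  assumes "k < length p" "i < p ! k"
  shows "block_start p k + i < sum_list p"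
proof -
  have "block_start p k + i < block_start p (Suc k)" using assms by (simp add: block_start_Suc)
  also have "\<dots> \<le> block_start p (length p)" using assms by (intro block_start_mono) simp
  finally show ?thesis by (simp only: block_start_length)
qed

lemma block_index_eq:
  assumes "k < length p" "i < p ! k"
  shows "block_index p (block_start p k + i) = k"
  unfolding block_index_def
proof (rule Least_equality)
  show "block_start p k + i < block_start p (Suc k)" using assms by (simp add: block_start_Suc)
next
  fix j assume j: "block_start p k + i < block_start p (Suc j)"
  show "k \<le> j"
  proof (rule ccontr)
    assume "\<not> k \<le> j"
    then have "block_start p (Suc j) \<le> block_start p k" by (intro block_start_mono) simp
    then show False using j by simp
  qed
qed

lemma block_position_cases:
  assumes "r < sum_list p"
  obtains k i where "k < length p" "i < p ! k" "r = block_start p k + i"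
proof -
  have "\<exists>k<m. \<exists>i<p ! k. r = block_start p k + i" if "m \<le> length p" "r < block_start p m" for m
    using that
  proof (induction m)
    case 0
    then show ?case by (simp add: block_start_def)
  next
    case (Suc m)
    show ?case
    proof (cases "r < block_start p m")
      case True
      then show ?thesis using Suc by (auto intro: less_SucI)
    next
      case False
      then show ?thesis using Suc.prems
        by (intro exI[of _ m] conjI exI[of _ "r - block_start p m"]) (auto simp: block_start_Suc)
    qed
  qed
  from this[of "length p"] show thesis using assms that by (auto simp: block_start_length)
qed

text \<open>When index classes are listed one after the other, positions in the list match positions
  in the block matrix.\<close>

lemma concat_nth_block:
  assumes "k < length xss" "i < length (xss ! k)"
  shows "concat xss ! (block_start (map length xss) k + i) = xss ! k ! i"
  using assms
proof (induction xss arbitrary: k)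
  case Nil
  then show ?case by simp
next
  case (Cons xs xss)
  then show ?case
    by (cases k) (auto simp: block_start_def nth_append add.assoc)
qed

section \<open>Conjugation by permutation matrices and the entries of U(p, \<Pi>)\<close>

lemma permutation_conj_index:
  fixes A :: "'a :: semiring_1 mat"
  assumes \<pi>: "\<pi> permutes {..<n}" and A: "A \<in> carrier_mat n n" and "r < n" "s < n"
  defines "P \<equiv> mat n n (\<lambda>(i,j). if j = \<pi> i then 1 else 0)"
  shows "(P * A * transpose_mat P) $$ (r,s) = A $$ (\<pi> r, \<pi> s)"
proof -
  have lt: "\<pi> i < n" if "i < n" for i using permutes_in_image[OF \<pi>, of i] that by simp
  have P: "P \<in> carrier_mat n n" by (simp add: P_def)
  have P_index: "P $$ (i,j) = (if j = \<pi> i then 1 else 0)" if "i < n" "j < n" for i j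
    using that by (simp add: P_def)
  have PA: "(P * A) $$ (i,j) = A $$ (\<pi> i, j)" if "i < n" "j < n" for i j
  proof -
    have "(P * A) $$ (i,j) = (\<Sum>k = 0..<n. P $$ (i,k) * A $$ (k,j))"
      using A P that by (simp add: scalar_prod_def)
    also have "\<dots> = (\<Sum>k = 0..<n. if k = \<pi> i then A $$ (k,j) else 0)"
      using that by (intro sum.cong) (auto simp: P_index)
    finally show ?thesis using lt[OF that(1)] by simp
  qed
  have "(P * A * transpose_mat P) $$ (r,s) = (\<Sum>k = 0..<n. (P * A) $$ (r,k) * P $$ (s,k))"
    using A P assms(3,4) by (simp add: scalar_prod_def del: assoc_mult_mat)
  also have "\<dots> = (\<Sum>k = 0..<n. if k = \<pi> s then A $$ (\<pi> r, k) else 0)"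
    using assms(3,4) by (intro sum.cong) (auto simp: PA P_index)
  also have "\<dots> = A $$ (\<pi> r, \<pi> s)" using lt[OF assms(4)] by simp
  finally show ?thesis .
qed

text \<open>Thus \<open>\<pi> j\<close> is the rank of block j in the triangular order, and S blocks
  stand exactly where the column block has smaller rank than the row block.\<close>

lemma eta_index:
  assumes "\<pi> permutes {..<m}" "j < m" "k < m"
  shows "eta m (mat m m (\<lambda>(i,j). if j = \<pi> i then 1 else 0)) $$ (j,k) = (if \<pi> k < \<pi> j then 1 else 0)"
proof -
  have "\<pi> j < m" "\<pi> k < m" using permutes_in_image[OF assms(1)] assms(2,3) by auto
  then show ?thesis
    unfolding eta_def using assms by (subst permutation_conj_index) (auto simp: tau_def)
qed

text \<open>One formula serves both block types, since a Z block differs from an S block only in the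
  last column.\<close>

lemma U_mat_index:
  assumes "j < length p" "k < length p" "r < p ! j" "s < p ! k"
  shows "U_mat p P a $$ (block_start p j + r, block_start p k + s) =
    (if eta (length p) P $$ (j,k) = 0 \<and> \<not> s < p ! k - 1 then - (\<Sum>i<p ! k - 1. a j k $ i) else a j k $ s)"
  using assms
  by (auto simp: U_mat_def block_mat_def Let_def block_start_add_less block_index_eq B_block_def
      Z_block_def S_block_def)

lemma U_mat_carrier: "U_mat p P a \<in> carrier_mat (sum_list p) (sum_list p)"
  by (simp add: U_mat_def block_mat_def)

lemma sum_with_compensating_last:
  fixes f :: "nat \<Rightarrow> 'a :: ab_group_add"
  assumes "0 < l"
  shows "(\<Sum>s<l. if s < l - 1 then f s else - (\<Sum>i<l - 1. f i)) = 0"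
proof -
  obtain l' where "l = Suc l'" using assms gr0_implies_Suc by blast
  then show ?thesis by simp
qed

section \<open>The number of parameters\<close>

text \<open>Each block in block column k contributes p_k - 1 parameters, and each S block one more.
  This gives m(n - m) + m(m - 1)/2, whatever \<Pi> is.\<close>

lemma card_U_parameters:
  assumes part: "int_partition n p" and P: "permutation_mat (length p) P"
  shows "real (card (U_parameters p P)) = real (length p) * (real n - (real (length p) + 1) / 2)"
proof -
  define m where "m = length p"
  obtain \<pi> where \<pi>: "\<pi> permutes {..<m}" and P: "P = mat m m (\<lambda>(i,j). if j = \<pi> i then 1 else 0)"
    using P unfolding permutation_mat_def m_def by blast
  have pos: "0 < p ! k" if "k < m" for k using part that by (simp add: int_partition_def m_def)
  have sum_p: "(\<Sum>k<m. real (p ! k)) = real n"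
    using part by (simp add: int_partition_def m_def sum_list_sum_nth atLeast0LessThan flip: of_nat_sum)
  have B: "B_block 0 k l = Z_block k l" "B_block (Suc 0) k l = S_block k l" for k l
    by (auto simp: B_block_def)
  have "U_parameters p P =
      (SIGMA j:{..<m}. SIGMA k:{..<m}. {..<(if \<pi> k < \<pi> j then p ! k else p ! k - 1)})"
    using pos \<pi>
    by (auto simp: U_parameters_def P eta_index B depends_on_coord_S_block
        depends_on_coord_Z_block m_def[symmetric] split: if_splits)
  then have "real (card (U_parameters p P)) =
      (\<Sum>j<m. \<Sum>k<m. real (if \<pi> k < \<pi> j then p ! k else p ! k - 1))"
    by simp
  also have "\<dots> = (\<Sum>j<m. \<Sum>k<m. (real (p ! k) - 1) + (if \<pi> k < \<pi> j then 1 else 0))"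
    using pos by (intro sum.cong) (auto simp: of_nat_diff Suc_le_eq)
  also have "\<dots> = real m * (real n - real m) + (\<Sum>j<m. \<Sum>k<m. if \<pi> k < \<pi> j then 1 else 0)"
    by (simp add: sum.distrib sum_subtractf sum_p)
  \<comment> \<open>Reindexing both sums by \<pi> reduces the count of S blocks to the count of
    entries below the diagonal.\<close>
  also have "(\<Sum>j<m. \<Sum>k<m. if \<pi> k < \<pi> j then 1 else 0) = (\<Sum>j<m. \<Sum>k<m. if k < j then 1 else (0::real))"
    by (subst (2) sum.permute[OF \<pi>], subst sum.permute[OF \<pi>, of "\<lambda>k. if k < _ then 1 else 0"])
      (simp add: o_def)
  also have "\<dots> = (\<Sum>j<m. real j)"
  proof (rule sum.cong)
    fix j assume "j \<in> {..<m}"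
    then have "{..<m} \<inter> {k. k < j} = {..<j}" by auto
    then show "(\<Sum>k<m. if k < j then 1 else 0) = real j" by (simp add: sum.If_cases)
  qed simp
  also have "\<dots> = real m * (real m - 1) / 2"
    by (induction m) (auto simp: field_simps)
  finally show ?thesis by (simp add: m_def field_simps)
qed

section \<open>Passing between U(p, \<Pi>) and triangular class sums\<close>

lemma nth_permutes:
  assumes "distinct xs" "set xs = {..<m}"
  shows "(\<lambda>i. if i < m then xs ! i else i) permutes {..<m}"
proof (rule bij_imp_permutes)
  have "length xs = m" using assms distinct_card by fastforce
  then have "bij_betw ((!) xs) {..<m} {..<m}" using bij_betw_nth[of xs] assms by simp
  then show "bij_betw (\<lambda>i. if i < m then xs ! i else i) {..<m} {..<m}"
    by (rule bij_betw_cong[THEN iffD1, rotated]) simp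
qed simp

lemma universal_U_mat:
  assumes part: "int_partition n p" and P: "permutation_mat (length p) P"
  shows "universal (U_mat p P a)"
proof -
  define m where "m = length p"
  obtain \<pi> where \<pi>: "\<pi> permutes {..<m}" and P: "P = mat m m (\<lambda>(i,j). if j = \<pi> i then 1 else 0)"
    using P unfolding permutation_mat_def m_def by blast
  have pos: "0 < p ! k" if "k < m" for k using part that by (simp add: int_partition_def m_def)
  have entry: "U_mat p P a $$ (block_start p j + r, block_start p k + s) =
      (if \<not> \<pi> k < \<pi> j \<and> \<not> s < p ! k - 1 then - (\<Sum>i<p ! k - 1. a j k $ i) else a j k $ s)"
    if "j < m" "k < m" "r < p ! j" "s < p ! k" for j k r s
    using that U_mat_index[of j p k r s P a] \<pi> by (simp add: P eta_index m_def[symmetric])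
  \<comment> \<open>The class of a row is the rank of its block.\<close>
  define c where "c r = \<pi> (block_index p r)" for r
  have c: "c (block_start p j + r) = \<pi> j" if "j < m" "r < p ! j" for j r
    using that by (simp add: c_def block_index_eq m_def)
  show ?thesis
  proof (rule universal_if_triangular_class_sums[where c = c, OF U_mat_carrier])
    fix r r' assume r: "r < sum_list p" and r': "r' < sum_list p" and eq: "c r = c r'"
    obtain j i where j: "j < m" "i < p ! j" "r = block_start p j + i"
      using block_position_cases[OF r] unfolding m_def by blast
    obtain j' i' where j': "j' < m" "i' < p ! j'" "r' = block_start p j' + i'"
      using block_position_cases[OF r'] unfolding m_def by blast
    have "j = j'"
      using eq c j j' permutes_inj[OF \<pi>] by (auto dest: injD)
    show "row (U_mat p P a) r = row (U_mat p P a) r'"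
    proof (rule eq_vecI)
      fix s assume "s < dim_vec (row (U_mat p P a) r')"
      then have s: "s < sum_list p" using U_mat_carrier[of p P a] by auto
      obtain k l where "k < m" "l < p ! k" "s = block_start p k + l"
        using block_position_cases[OF s] unfolding m_def by blast
      then show "row (U_mat p P a) r $ s = row (U_mat p P a) r' $ s"
        using U_mat_carrier[of p P a] r r' s j j' entry \<open>j = j'\<close> by simp
    qed simp
  next
    fix r \<kappa> assume r: "r < sum_list p" and \<kappa>: "c r \<le> \<kappa>"
    obtain j i where j: "j < m" "i < p ! j" "r = block_start p j + i"
      using block_position_cases[OF r] unfolding m_def by blast
    \<comment> \<open>\<pi> is a bijection of all natural numbers, so every \<kappa> is the rank of
      some k; for k outside the block range the class is empty.\<close>
    obtain k where k: "\<kappa> = \<pi> k" using permutes_surj[OF \<pi>] by auto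
    show "(\<Sum>s | s < sum_list p \<and> c s = \<kappa>. U_mat p P a $$ (r,s)) = 0"
    proof (cases "k < m")
      case True
      have "{s. s < sum_list p \<and> c s = \<kappa>} = (\<lambda>l. block_start p k + l) ` {..<p ! k}"
      proof (intro equalityI subsetI)
        fix s assume "s \<in> {s. s < sum_list p \<and> c s = \<kappa>}"
        then have s: "s < sum_list p" "c s = \<pi> k" using k by auto
        obtain k' l where k': "k' < m" "l < p ! k'" "s = block_start p k' + l"
          using block_position_cases[OF s(1)] unfolding m_def by blast
        then have "k' = k" using s(2) c permutes_inj[OF \<pi>] by (auto dest: injD)
        then show "s \<in> (\<lambda>l. block_start p k + l) ` {..<p ! k}" using k' by auto
      next
        fix s assume "s \<in> (\<lambda>l. block_start p k + l) ` {..<p ! k}"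
        then show "s \<in> {s. s < sum_list p \<and> c s = \<kappa>}"
          using True c k block_start_add_less[of k p] by (auto simp: m_def)
      qed
      then have "(\<Sum>s | s < sum_list p \<and> c s = \<kappa>. U_mat p P a $$ (r,s)) =
          (\<Sum>l<p ! k. U_mat p P a $$ (r, block_start p k + l))"
        by (simp add: sum.reindex)
      \<comment> \<open>\<open>c r \<le> \<kappa>\<close> excludes an S block, so the class sum is a
        row sum of a Z block.\<close>
      also have "\<dots> = (\<Sum>l<p ! k. if l < p ! k - 1 then a j k $ l else - (\<Sum>i<p ! k - 1. a j k $ i))"
        using True j \<kappa> c k by (intro sum.cong) (auto simp: entry)
      also have "\<dots> = 0" by (rule sum_with_compensating_last[OF pos[OF True]])
      finally show ?thesis .
    next
      case False
      have "c s \<noteq> \<kappa>" if s: "s < sum_list p" for s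
      proof -
        obtain k' l where "k' < m" "l < p ! k'" "s = block_start p k' + l"
          using block_position_cases[OF s] unfolding m_def by blast
        then show ?thesis using False c k permutes_inj[OF \<pi>] by (auto dest: injD)
      qed
      then have "{s. s < sum_list p \<and> c s = \<kappa>} = {}" by auto
      then show ?thesis by (simp only: sum.empty)
    qed
  qed
qed

lemma triangular_class_sums_imp_similar_U_mat:
  fixes c :: "nat \<Rightarrow> nat"
  assumes A: "A \<in> carrier_mat n n" and img: "c ` {..<n} = {..<m}"
    and rows: "\<And>r r'. r < n \<Longrightarrow> r' < n \<Longrightarrow> c r = c r' \<Longrightarrow> row A r = row A r'"
    and sums: "\<And>r \<kappa>. r < n \<Longrightarrow> c r \<le> \<kappa> \<Longrightarrow> (\<Sum>s | s < n \<and> c s = \<kappa>. A $$ (r,s)) = 0"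
  shows "\<exists>p P a. int_partition n p \<and> permutation_mat (length p) P \<and> param_family p a \<and>
    permutation_similar A (U_mat p P a)"
proof -
  define C where "C \<kappa> = {r. r < n \<and> c r = \<kappa>}" for \<kappa>
  have finC: "finite (C \<kappa>)" for \<kappa> by (simp add: C_def)
  have C_nonempty: "C \<kappa> \<noteq> {}" if "\<kappa> < m" for \<kappa>
  proof -
    have "\<kappa> \<in> c ` {..<n}" using img that by simp
    then show ?thesis by (auto simp: C_def)
  qed
  \<comment> \<open>A partition must be nondecreasing, so the blocks are arranged by class size. The
    triangular order is not lost: it is recorded in \<open>qs\<close>, which becomes the permutation
    behind \<Pi>.\<close>
  define qs where "qs = sort_key (\<lambda>\<kappa>. card (C \<kappa>)) [0..<m]"
  have qs: "distinct qs" "set qs = {..<m}" "length qs = m"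
    by (auto simp: qs_def)
  have qs_lt: "qs ! j < m" if "j < m" for j using qs that nth_mem[of j qs] by auto
  define xss where "xss = map (\<lambda>\<kappa>. sorted_list_of_set (C \<kappa>)) qs"
  define L where "L = concat xss"
  define p where "p = map length xss"
  have len_p: "length p = m" by (simp add: p_def xss_def qs)
  have xss_nth: "xss ! j = sorted_list_of_set (C (qs ! j))" if "j < m" for j
    using that qs by (simp add: xss_def)
  have p_nth: "p ! j = length (xss ! j)" if "j < m" for j
    using that qs by (simp add: p_def xss_def)
  have set_L: "set L = {..<n}"
    using img by (auto simp: L_def xss_def qs finC C_def)
  have "distinct L"
    unfolding L_def
  proof (rule distinct_concat)
    have "inj_on (\<lambda>\<kappa>. sorted_list_of_set (C \<kappa>)) {..<m}"
    proof (rule inj_onI)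
      fix \<kappa> \<kappa>' assume *: "\<kappa> \<in> {..<m}" "\<kappa>' \<in> {..<m}" "sorted_list_of_set (C \<kappa>) = sorted_list_of_set (C \<kappa>')"
      then have "C \<kappa> = C \<kappa>'" using finC sorted_list_of_set_inject by blast
      then show "\<kappa> = \<kappa>'" using C_nonempty * by (auto simp: C_def)
    qed
    then show "distinct xss" using qs by (simp add: xss_def distinct_map)
  next
    fix ys zs assume "ys \<in> set xss" "zs \<in> set xss" "ys \<noteq> zs"
    then show "set ys \<inter> set zs = {}" by (auto simp: xss_def finC C_def)
  qed (auto simp: xss_def)
  then have len_L: "length L = n" using distinct_card[of L] set_L by simp
  have sum_p: "sum_list p = n" using len_L by (simp add: p_def L_def length_concat)
  have L_nth: "L ! (block_start p j + i) = xss ! j ! i" if "j < m" "i < p ! j" for i j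
    using concat_nth_block[of j xss i] that qs p_nth by (simp add: L_def p_def xss_def)
  have L_class: "L ! (block_start p j + i) < n" "c (L ! (block_start p j + i)) = qs ! j"
    if "j < m" "i < p ! j" for i j
  proof -
    have "xss ! j ! i \<in> set (xss ! j)" using that p_nth by simp
    then show "L ! (block_start p j + i) < n" "c (L ! (block_start p j + i)) = qs ! j"
      using that by (auto simp: L_nth xss_nth finC C_def)
  qed
  \<comment> \<open>Block k of the list \<open>L\<close> enumerates class \<open>qs ! k\<close>,
    which turns class sums into sums over block columns.\<close>
  have class_sum: "(\<Sum>s | s < n \<and> c s = qs ! k. f s) = (\<Sum>l<p ! k. f (L ! (block_start p k + l)))"
    if k: "k < m" for k and f :: "nat \<Rightarrow> complex"
  proof -
    have "(\<Sum>s | s < n \<and> c s = qs ! k. f s) = sum f (set (xss ! k))"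
      using k by (simp add: xss_nth finC C_def)
    also have "\<dots> = sum_list (map f (xss ! k))"
      using k by (simp add: xss_nth sum_list_distinct_conv_sum_set)
    also have "\<dots> = (\<Sum>l<p ! k. f (xss ! k ! l))"
      using k by (simp add: sum_list_sum_nth p_nth atLeast0LessThan)
    also have "\<dots> = (\<Sum>l<p ! k. f (L ! (block_start p k + l)))"
      using k by (intro sum.cong) (auto simp: L_nth)
    finally show ?thesis .
  qed
  have p_pos: "0 < p ! j" if "j < m" for j
    using C_nonempty[OF qs_lt[OF that]] finC that by (simp add: p_nth xss_nth card_gt_0_iff)
  have part: "int_partition n p"
    unfolding int_partition_def
  proof (intro conjI ballI)
    have "p = map (\<lambda>\<kappa>. card (C \<kappa>)) qs" by (simp add: p_def xss_def)
    then show "sorted p" by (simp add: qs_def)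
  next
    fix q assume "q \<in> set p"
    then show "0 < q" using p_pos len_p by (auto simp: in_set_conv_nth)
  qed (fact sum_p)
  \<comment> \<open>\<pi> permutes the blocks, while \<sigma> below permutes the matrix indices;
    both are the identity outside their range, as \<open>permutes\<close> demands.\<close>
  define \<pi> where "\<pi> j = (if j < m then qs ! j else j)" for j
  have \<pi>: "\<pi> permutes {..<m}" unfolding \<pi>_def by (rule nth_permutes[OF qs(1,2)])
  define P :: "nat mat" where "P = mat m m (\<lambda>(i,j). if j = \<pi> i then 1 else 0)"
  define \<sigma> where "\<sigma> r = (if r < n then L ! r else r)" for r
  have \<sigma>: "\<sigma> permutes {..<n}" unfolding \<sigma>_def by (rule nth_permutes[OF \<open>distinct L\<close> set_L])
  define Q :: "complex mat" where "Q = mat n n (\<lambda>(i,j). if j = \<sigma> i then 1 else 0)"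
  \<comment> \<open>All rows of a block row agree, so its first row supplies the parameters.\<close>
  define a where "a j k = vec (p ! k) (\<lambda>s. A $$ (L ! block_start p j, L ! (block_start p k + s)))" for j k
  have "Q * A * transpose_mat Q = U_mat p P a"
  proof (rule eq_matI)
    fix r s assume "r < dim_row (U_mat p P a)" "s < dim_col (U_mat p P a)"
    then have r: "r < sum_list p" and s: "s < sum_list p" using U_mat_carrier[of p P a] by auto
    obtain j i where j: "j < m" "i < p ! j" "r = block_start p j + i"
      using block_position_cases[OF r] unfolding len_p by blast
    obtain k l where k: "k < m" "l < p ! k" "s = block_start p k + l"
      using block_position_cases[OF s] unfolding len_p by blast
    let ?r = "L ! block_start p j"
    have r0: "?r < n" "c ?r = qs ! j" using L_class[OF j(1) p_pos[OF j(1)]] by simp_all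
    have "row A (L ! r) = row A ?r"
      using L_class[OF j(1,2)] r0 j(3) by (intro rows) simp_all
    moreover have "L ! r < n" "L ! s < n" using L_class j k by auto
    ultimately have entry: "A $$ (L ! r, L ! s) = a j k $ l"
      using A r0(1) k index_row(1)[of "L ! r" A "L ! s"] index_row(1)[of ?r A "L ! s"]
      by (simp add: a_def)
    have "(Q * A * transpose_mat Q) $$ (r,s) = a j k $ l"
      using permutation_conj_index[OF \<sigma> A, of r s] r s entry by (simp add: Q_def \<sigma>_def sum_p)
    \<comment> \<open>In a Z block only the last column needs an argument: the vanishing class sum
      forces its entry to be minus the sum of the others.\<close>
    moreover have "- (\<Sum>i<p ! k - 1. a j k $ i) = a j k $ l"
      if "\<not> \<pi> k < \<pi> j" "\<not> l < p ! k - 1"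
    proof -
      have "(\<Sum>i<p ! k. a j k $ i) = (\<Sum>i<p ! k. A $$ (?r, L ! (block_start p k + i)))"
        by (simp add: a_def)
      also have "\<dots> = 0"
        using sums[OF r0(1), of "qs ! k"] class_sum[OF k(1), of "\<lambda>s. A $$ (?r, s)"] that(1) r0(2) j k
        by (simp add: \<pi>_def)
      finally have "(\<Sum>i<p ! k. a j k $ i) = 0" .
      moreover have "p ! k = Suc l" using that(2) k(2) by simp
      ultimately show ?thesis by (simp add: minus_unique)
    qed
    ultimately show "(Q * A * transpose_mat Q) $$ (r,s) = U_mat p P a $$ (r,s)"
      using U_mat_index[of j p k i l P a] j k \<pi> by (simp add: P_def eta_index len_p)
  qed (use U_mat_carrier[of p P a] in \<open>auto simp: Q_def sum_p\<close>)
  then have "permutation_similar A (U_mat p P a)"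
    unfolding permutation_similar_def
    using A \<sigma> U_mat_carrier[of p P a] by (auto simp: permutation_mat_def Q_def sum_p)
  moreover have "permutation_mat (length p) P"
    using \<pi> by (auto simp: permutation_mat_def P_def len_p)
  moreover have "param_family p a" by (simp add: param_family_def a_def)
  ultimately show ?thesis using part by blast
qed

theorem theorem4p13:
  fixes n :: nat
  assumes "n \<ge> 2"
  shows
    "(\<forall>A \<in> carrier_mat n n. universal A \<longrightarrow>
        (\<exists>p P a. int_partition n p \<and> permutation_mat (length p) P \<and> param_family p a \<and>
           permutation_similar A (U_mat p P a)))
     \<and>
     (\<forall>p P. int_partition n p \<and> permutation_mat (length p) P \<longrightarrow>
        (\<forall>a. param_family p a \<longrightarrow> universal (U_mat p P a)) \<and>
        real (card (U_parameters p P)) =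
          real (length p) * (real n - (real (length p) + 1) / 2))"
proof (intro conjI ballI allI impI)
  fix A assume A: "A \<in> carrier_mat n n" and univ: "universal A"
  show "\<exists>p P a. int_partition n p \<and> permutation_mat (length p) P \<and> param_family p a \<and>
      permutation_similar A (U_mat p P a)"
    by (rule universal_imp_triangular_class_sums[OF A univ])
      (rule triangular_class_sums_imp_similar_U_mat[OF A])
next
  fix p and P :: "nat mat" assume p: "int_partition n p \<and> permutation_mat (length p) P"
  show "universal (U_mat p P a)" for a
    using p by (blast intro: universal_U_mat)
  show "real (card (U_parameters p P)) = real (length p) * (real n - (real (length p) + 1) / 2)"
    using p by (blast intro: card_U_parameters)
qed

end
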